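(* Suppose that $\mathfrak{P}_+\neq\emptyset$. Then for any $c\in\bar{\mathfrak{C}}_+$ there exists a bounded nonnegative measure $d\mu$ on $K$ such that $c=\int_K\alpha\,d\mu$, i.e. $c_k=\int_K\alpha_k\,d\mu$ for $k=1,\dots,n$.
   Context: $K\subset\mathbb{R}^d$ is a compact set with $d$-dimensional (nonempty) interior whose closure is precisely $K$. $\alpha_1,\dots,\alpha_n$ are real-valued, continuous, linearly independent functions on $K$, and $\alpha=(\alpha_1,\dots,\alpha_n)'$ is the corresponding column vector of functions. For $p=(p_1,\dots,p_n)\in\mathbb{R}^n$ write $P(x)=\sum_{k=1}^n p_k\alpha_k(x)$. $\mathfrak{P}_+$ is the set of $p\in\mathbb{R}^n$ such that $P(x)>0$ for all $x\in K$; $\bar{\mathfrak{P}}_+$ is its closure. Standing assumption: for every $p\in\bar{\mathfrak{P}}_+\setminus\{0\}$ the zero set of $P$ in $K$ has Lebesgue measure zero. With $\langle c,p\rangle=\sum_{k=1}^n c_kp_k$, let $\mathfrak{C}_+=\{c\in\mathbb{R}^n\mid \langle c,p\rangle>0 \text{ for all } p\in\bar{\mathfrak{P}}_+\setminus\{0\}\}$, and let $\bar{\mathfrak{C}}_+$ be its closure. Measures are Borel measures on $K$. *)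

theory Defs
  imports "HOL-Analysis.Analysis"
begin

definition gen_poly :: "('n :: finite \<Rightarrow> real ^ 'd \<Rightarrow> real) \<Rightarrow> real ^ 'n \<Rightarrow> real ^ 'd \<Rightarrow> real" where
  "gen_poly \<alpha> p x = (\<Sum>k\<in>UNIV. p $ k * \<alpha> k x)"

(* Linear independence of the indexed family of restrictions of the functions to K;
   in particular repeated functions are dependent. The library's independent needs a
   real_vector instance, which function types do not have, and speaks of sets, not families. *)
definition lin_indep_on :: "(real ^ 'd) set \<Rightarrow> ('n :: finite \<Rightarrow> real ^ 'd \<Rightarrow> real) \<Rightarrow> bool" where
  "lin_indep_on K \<alpha> \<longleftrightarrow> (\<forall>p. (\<forall>x\<in>K. gen_poly \<alpha> p x = 0) \<longrightarrow> p = 0)"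

definition P_plus :: "(real ^ 'd) set \<Rightarrow> ('n :: finite \<Rightarrow> real ^ 'd \<Rightarrow> real) \<Rightarrow> (real ^ 'n) set" where
  "P_plus K \<alpha> = {p. \<forall>x\<in>K. gen_poly \<alpha> p x > 0}"

definition C_plus :: "(real ^ 'd) set \<Rightarrow> ('n :: finite \<Rightarrow> real ^ 'd \<Rightarrow> real) \<Rightarrow> (real ^ 'n) set" where
  "C_plus K \<alpha> = {c. \<forall>p \<in> closure (P_plus K \<alpha>) - {0}. c \<bullet> p > 0}"

end

theory Submission
  imports Defs
begin

text \<open>
  The moment vectors of the point masses form a compact set \<open>S\<close>, and \<open>\<PP>\<^sub>+ \<noteq> {}\<close> says that \<open>S\<close> lies
  in an open half-space, so the convex cone generated by \<open>S\<close> is closed.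
  A vector \<open>c\<close> outside this cone would be separated from it by some \<open>p\<close> with \<open>P \<ge> 0\<close> on \<open>K\<close> and
  \<open>\<langle>c, p\<rangle> < 0\<close>. Adding small multiples of an element of \<open>\<PP>\<^sub>+\<close> shows that such a \<open>p\<close> lies in the closure
  of \<open>\<PP>\<^sub>+\<close>, on which \<open>c\<close> is nonnegative. Hence \<open>c\<close> is a finite nonnegative combination of
  moment vectors of point masses.
\<close>

definition moment_curve :: "('n :: finite \<Rightarrow> real ^ 'd \<Rightarrow> real) \<Rightarrow> real ^ 'd \<Rightarrow> real ^ 'n" where
  "moment_curve \<alpha> x = (\<chi> k. \<alpha> k x)"

lemma gen_poly_eq_inner: "gen_poly \<alpha> p x = p \<bullet> moment_curve \<alpha> x"
  by (simp add: gen_poly_def moment_curve_def inner_vec_def)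

lemma nonneg_in_closure_P_plus:
  assumes "P_plus K \<alpha> \<noteq> {}" and nonneg: "\<And>x. x \<in> K \<Longrightarrow> gen_poly \<alpha> p x \<ge> 0"
  shows "p \<in> closure (P_plus K \<alpha>)"
proof -
  obtain q where q: "q \<in> P_plus K \<alpha>"
    using assms(1) by blast
  have "p + inverse (real (Suc m)) *\<^sub>R q \<in> P_plus K \<alpha>" for m
    using q nonneg
    by (auto simp: P_plus_def gen_poly_eq_inner inner_add_left intro!: add_nonneg_pos)
  moreover have "(\<lambda>m. p + inverse (real (Suc m)) *\<^sub>R q) \<longlonglongrightarrow> p + 0 *\<^sub>R q"
    by (intro tendsto_intros LIMSEQ_inverse_real_of_nat)
  ultimately show ?thesis
    unfolding closure_sequential
    by (intro exI[of _ "\<lambda>m. p + inverse (real (Suc m)) *\<^sub>R q"]) simp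
qed

lemma closure_C_plus_inner_nonneg:
  assumes "c \<in> closure (C_plus K \<alpha>)" "p \<in> closure (P_plus K \<alpha>)"
  shows "c \<bullet> p \<ge> 0"
proof -
  \<comment> \<open>The case \<open>p = 0\<close> is split off because \<open>C_plus\<close> tests
    only nonzero \<open>p\<close>; there the pairing is simply 0.\<close>
  have "C_plus K \<alpha> \<subseteq> {c. p \<bullet> c \<ge> 0}"
    using assms(2) by (cases "p = 0") (auto simp: C_plus_def inner_commute intro: less_imp_le)
  then have "closure (C_plus K \<alpha>) \<subseteq> {c. p \<bullet> c \<ge> 0}"
    by (rule closure_minimal) (rule closed_halfspace_ge)
  with assms(1) show ?thesis
    by (auto simp: inner_commute)
qed

text \<open>A Farkas-type criterion. The functional \<open>q\<close> serves only to make the cone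
  closed; a hyperplane strictly separating \<open>c\<close> from it then yields a \<open>p\<close>
  that contradicts \<open>dual\<close>.\<close>

lemma mem_conic_hull_if_inner_nonneg:
  fixes S :: "'a :: euclidean_space set"
  assumes S: "compact S" "S \<noteq> {}"
    and pos: "\<And>x. x \<in> S \<Longrightarrow> q \<bullet> x > 0"
    and dual: "\<And>p. (\<And>x. x \<in> S \<Longrightarrow> p \<bullet> x \<ge> 0) \<Longrightarrow> p \<bullet> c \<ge> 0"
  shows "c \<in> conic hull (convex hull S)"
proof (rule ccontr)
  let ?T = "conic hull (convex hull S)"
  assume "c \<notin> ?T"
  have "convex hull S \<subseteq> {x. q \<bullet> x > 0}"
    by (rule hull_minimal) (auto simp: pos convex_halfspace_gt)
  \<comment> \<open>This is what closedness rests on: the cone over a compact convex set can fail to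
    be closed when 0 lies in the set, as for a disc touching the origin.\<close>
  then have "0 \<notin> convex hull S"
    by auto
  then have "closed ?T"
    by (simp add: closed_conic_hull compact_convex_hull S(1))
  moreover have "convex ?T"
    by (simp add: convex_conic_hull)
  ultimately obtain p b where pc: "p \<bullet> c < b" and pT: "\<And>x. x \<in> ?T \<Longrightarrow> p \<bullet> x > b"
    using separating_hyperplane_closed_point[of ?T c] \<open>c \<notin> ?T\<close> by blast
  have ray: "t * (p \<bullet> x) > b" if "x \<in> S" "t \<ge> 0" for x t
    using pT[of "t *\<^sub>R x"] that hull_inc[of x S] by (auto simp: conic_hull_explicit)
  have "b < 0"
    using S(2) ray[of _ 0] by auto
  have "p \<bullet> x \<ge> 0" if "x \<in> S" for x
  proof (rule ccontr)
    assume "\<not> p \<bullet> x \<ge> 0"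
    then show False
      \<comment> \<open>This multiple is nonnegative, and it moves \<open>x\<close> exactly onto the
        hyperplane at level \<open>b\<close>, where \<open>ray\<close> demands a value strictly
        above \<open>b\<close>.\<close>
      using ray[OF that, of "b / (p \<bullet> x)"] \<open>b < 0\<close> by (simp add: divide_nonpos_neg)
  qed
  then have "p \<bullet> c \<ge> 0"
    by (rule dual)
  with pc \<open>b < 0\<close> show False
    by simp
qed

text \<open>The measure is the image under \<open>g\<close> of the measure with weights
  \<open>v\<close> on the index set, so integrals become finite sums. Indices with the same image
  just add their weights, so \<open>g\<close> may fail to be injective.\<close>

lemma finite_atomic_measure_exists:
  fixes g :: "'i \<Rightarrow> 'a :: topological_space" and v :: "'i \<Rightarrow> real"
  assumes F: "finite F" and g: "\<And>i. i \<in> F \<Longrightarrow> g i \<in> K" and v: "\<And>i. i \<in> F \<Longrightarrow> v i \<ge> 0"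
  obtains \<mu> where "sets \<mu> = sets (restrict_space borel K)" "finite_measure \<mu>"
    "\<And>f :: 'a \<Rightarrow> real. continuous_on K f \<Longrightarrow>
       integrable \<mu> f \<and> (LINT x|\<mu>. f x) = (\<Sum>i\<in>F. v i * f (g i))"
proof
  let ?P = "point_measure F v" and ?R = "restrict_space borel K"
  let ?\<mu> = "distr ?P ?R g"
  show "sets ?\<mu> = sets ?R"
    by simp
  have g_meas: "g \<in> measurable ?P ?R"
    using g by (auto simp: measurable_def space_point_measure sets_point_measure space_restrict_space)
  have "finite_measure ?P"
    by (rule finite_measureI)
       (simp add: space_point_measure emeasure_point_measure_finite F v)
  then show "finite_measure ?\<mu>"
    using g_meas by (rule finite_measure.finite_measure_distr)
  fix f :: "'a \<Rightarrow> real"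
  assume "continuous_on K f"
  then have f_meas: "f \<in> borel_measurable ?R"
    by (rule borel_measurable_continuous_on_restrict)
  show "integrable ?\<mu> f \<and> (LINT x|?\<mu>. f x) = (\<Sum>i\<in>F. v i * f (g i))"
    using F v
    by (simp add: integrable_distr_eq[OF g_meas f_meas] integral_distr[OF g_meas f_meas]
        integrable_point_measure_finite lebesgue_integral_point_measure_finite)
qed

theorem theorem2p3:
  fixes K :: "(real ^ 'd) set"
    and \<alpha> :: "'n :: finite \<Rightarrow> real ^ 'd \<Rightarrow> real"
    and c :: "real ^ 'n"
  assumes "compact K"
    and "interior K \<noteq> {}"
    and "closure (interior K) = K"
    and "\<And>k. continuous_on K (\<alpha> k)"
    and "lin_indep_on K \<alpha>"
    and "\<And>p. p \<in> closure (P_plus K \<alpha>) - {0} \<Longrightarrow>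
            {x \<in> K. gen_poly \<alpha> p x = 0} \<in> null_sets lebesgue"
    and "P_plus K \<alpha> \<noteq> {}"
    and "c \<in> closure (C_plus K \<alpha>)"
  shows "\<exists>\<mu> :: (real ^ 'd) measure.
           sets \<mu> = sets (restrict_space borel K) \<and> finite_measure \<mu> \<and>
           (\<forall>k. integrable \<mu> (\<alpha> k) \<and> c $ k = (LINT x|\<mu>. \<alpha> k x))"
proof -
  let ?S = "moment_curve \<alpha> ` K"
  obtain q where q: "q \<in> P_plus K \<alpha>"
    using assms(7) by blast
  have "continuous_on K (moment_curve \<alpha>)"
    unfolding moment_curve_def by (intro continuous_on_vec_lambda assms(4))
  then have "compact ?S"
    using assms(1) compact_continuous_image by blast
  moreover have "?S \<noteq> {}"
    using assms(2) interior_subset by fastforce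
  moreover have "q \<bullet> s > 0" if "s \<in> ?S" for s
    using q that by (auto simp: P_plus_def gen_poly_eq_inner)
  moreover have "p \<bullet> c \<ge> 0" if "\<And>s. s \<in> ?S \<Longrightarrow> p \<bullet> s \<ge> 0" for p
  proof -
    have "p \<in> closure (P_plus K \<alpha>)"
      using that by (intro nonneg_in_closure_P_plus assms(7)) (simp add: gen_poly_eq_inner)
    then show ?thesis
      using closure_C_plus_inner_nonneg[OF assms(8)] by (subst inner_commute) blast
  qed
  ultimately have "c \<in> conic hull (convex hull ?S)"
    by (rule mem_conic_hull_if_inner_nonneg)
  then obtain t F u where "t \<ge> 0" and F: "finite F" "F \<subseteq> ?S"
    and u: "\<And>s. s \<in> F \<Longrightarrow> u s \<ge> 0" and c: "c = t *\<^sub>R (\<Sum>s\<in>F. u s *\<^sub>R s)"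
    unfolding conic_hull_explicit convex_hull_explicit by blast
  \<comment> \<open>Each moment vector in \<open>F\<close> needs a point of \<open>K\<close> to
    carry its atom; since \<open>moment_curve \<alpha>\<close> may take a value repeatedly, one
    preimage is chosen.\<close>
  obtain g where g: "\<And>s. s \<in> F \<Longrightarrow> g s \<in> K" "\<And>s. s \<in> F \<Longrightarrow> moment_curve \<alpha> (g s) = s"
  proof
    show "inv_into K (moment_curve \<alpha>) s \<in> K"
      and "moment_curve \<alpha> (inv_into K (moment_curve \<alpha>) s) = s" if "s \<in> F" for s
      using that F(2) by (auto intro: inv_into_into f_inv_into_f)
  qed
  obtain \<mu> where \<mu>: "sets \<mu> = sets (restrict_space borel K)" "finite_measure \<mu>"
    and int: "\<And>f :: real ^ 'd \<Rightarrow> real. continuous_on K f \<Longrightarrow>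
       integrable \<mu> f \<and> (LINT x|\<mu>. f x) = (\<Sum>s\<in>F. (t * u s) * f (g s))"
  proof (rule finite_atomic_measure_exists[OF F(1), of g K "\<lambda>s. t * u s"])
    show "t * u s \<ge> 0" if "s \<in> F" for s
      using u[OF that] \<open>t \<ge> 0\<close> by simp
  qed (auto intro: g(1))
  \<comment> \<open>The cone factor \<open>t\<close> and the convex weights \<open>u\<close> merge
    into the masses \<open>t * u s\<close> of the atoms at \<open>g s\<close>.\<close>
  have "c $ k = (\<Sum>s\<in>F. (t * u s) * \<alpha> k (g s))" for k
  proof -
    have "s $ k = \<alpha> k (g s)" if "s \<in> F" for s
      using arg_cong[OF g(2)[OF that], of "\<lambda>y. y $ k"] by (simp add: moment_curve_def)
    then show ?thesis
      by (simp add: c sum_distrib_left mult.assoc)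
  qed
  with \<mu> int assms(4) show ?thesis
    by (intro exI[of _ \<mu>]) simp
qed

end
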